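(* Let $\mathscr Y_{\mathrm{Pyth}}$ be the rational-ray visibility datum on the positive part of the cone $V_{\mathrm{Pyth}}:X^2+Y^2=Z^2$ in $\mathbb A^3$. Then $$\mathfrak d^{\mathrm{vis}}(\mathscr Y_{\mathrm{Pyth}})=0,\qquad \mathfrak d_p^{\mathrm{vis}}(\mathscr Y_{\mathrm{Pyth}})=1-\frac1p$$ for every prime $p$. Visibility is locally detectable (a branch point is globally visible if and only if it is $p$-adically visible for every prime $p$), and $$\mathfrak d^{\mathrm{vis}}(\mathscr Y_{\mathrm{Pyth}})=\prod_p\mathfrak d_p^{\mathrm{vis}}(\mathscr Y_{\mathrm{Pyth}}).$$
   Context: Rational-ray datum of a homogeneous affine variety $V\subseteq\mathbb A^n$ over $\mathbb Q$: for every class $[v]\in(V(\mathbb Q)\cap\mathbb Q_{>0}^n)/\mathbb Q_{>0}$ choose a representative $v$ and take the ordered branch $\phi_{[v]}(t)=tv$, $t>0$. The branch locus is $\mathcal B=V(\mathbb Z)\cap\mathbb Z_{>0}^n$ (here: positive integral Pythagorean triples). For $P\in\mathbb Z^n$, $v_p(P)=\min_iv_p(P_i)$ and $H(P)=\max_i|P_i|$. A branch point $\phi_{[v]}(t)$ is globally visible if there is no real $s$ with $0<s<t$ and $\phi_{[v]}(s)\in\mathbb Z^n$; it is $p$-adically visible if $v_p(\phi_{[v]}(t))\le v_p(\phi_{[v]}(s))$ for all such $s$. $\mathfrak d^{\mathrm{vis}}$ (resp. $\mathfrak d_p^{\mathrm{vis}}$) is the limit as $X\to\infty$ of the proportion of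 globally visible (resp. $p$-adically visible) points among the points of $\mathcal B$ with $H\le X$. Infinite products over primes are limits of partial products over $p\le Y$ (the value $0$ is allowed). *)

theory Defs
  imports "HOL-Analysis.Analysis" "HOL-Computational_Algebra.Primes"
begin

definition int_vec :: "int ^ 'n \<Rightarrow> 'a::ring_1 ^ 'n"
  where "int_vec P = (\<chi> i. of_int (P $ i))"

definition rat_vec :: "rat ^ 'n \<Rightarrow> 'a::field_char_0 ^ 'n"
  where "rat_vec v = (\<chi> i. of_rat (v $ i))"

definition int_val :: "nat \<Rightarrow> int \<Rightarrow> enat"
  where "int_val p a = (if a = 0 then \<infinity> else enat (multiplicity (int p) a))"

definition vec_val :: "nat \<Rightarrow> int ^ 'n::finite \<Rightarrow> enat"
  where "vec_val p P = Min (range (\<lambda>i. int_val p (P $ i)))"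

definition height :: "int ^ 'n::finite \<Rightarrow> int"
  where "height P = Max (range (\<lambda>i. \<bar>P $ i\<bar>))"


section \<open>Rational-ray data\<close>

text \<open>
  A variety over the rationals enters only through its set \<open>V\<close> of rational points;
  its integral points are the integer vectors whose image lies in \<open>V\<close>.
\<close>

definition pos_points :: "(rat ^ 'n) set \<Rightarrow> (rat ^ 'n) set"
  where "pos_points V = {v \<in> V. \<forall>i. 0 < v $ i}"

definition ray_rel :: "(rat ^ 'n) set \<Rightarrow> (rat ^ 'n) rel"
  where "ray_rel V =
    {(v, w). v \<in> pos_points V \<and> w \<in> pos_points V \<and> (\<exists>q>0. w = q *s v)}"

definition ray_classes :: "(rat ^ 'n) set \<Rightarrow> (rat ^ 'n) set set"
  where "ray_classes V = pos_points V // ray_rel V"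

definition ray_representatives ::
    "(rat ^ 'n) set \<Rightarrow> ((rat ^ 'n) set \<Rightarrow> rat ^ 'n) \<Rightarrow> bool"
  where "ray_representatives V rep \<longleftrightarrow> (\<forall>c \<in> ray_classes V. rep c \<in> c)"

definition branch ::
    "((rat ^ 'n) set \<Rightarrow> rat ^ 'n) \<Rightarrow> (rat ^ 'n) set \<Rightarrow> real \<Rightarrow> real ^ 'n"
  where "branch rep c t = t *s rat_vec (rep c)"

definition branch_locus :: "(rat ^ 'n) set \<Rightarrow> (int ^ 'n) set"
  where "branch_locus V = {P. int_vec P \<in> V \<and> (\<forall>i. 0 < P $ i)}"

text \<open>A branch point is recorded by its branch and its parameter on that branch.\<close>

definition branch_points ::
    "(rat ^ 'n) set \<Rightarrow> ((rat ^ 'n) set \<Rightarrow> rat ^ 'n) \<Rightarrow> ((rat ^ 'n) set \<times> real) set"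
  where "branch_points V rep =
    {(c, t). c \<in> ray_classes V \<and> 0 < t \<and> branch rep c t \<in> int_vec ` branch_locus V}"

definition globally_visible ::
    "((rat ^ 'n) set \<Rightarrow> rat ^ 'n) \<Rightarrow> (rat ^ 'n) set \<Rightarrow> real \<Rightarrow> bool"
  where "globally_visible rep c t \<longleftrightarrow>
    \<not> (\<exists>s. 0 < s \<and> s < t \<and> branch rep c s \<in> range int_vec)"

text \<open>
  The valuation lives on integer vectors, so the points of the branch at the parameters
  \<open>t\<close> and \<open>s\<close> are first identified with integer vectors \<open>P\<close> and \<open>Q\<close>, which are unique
  when they exist.
\<close>

definition adically_visible ::
    "nat \<Rightarrow> ((rat ^ 'n::finite) set \<Rightarrow> rat ^ 'n) \<Rightarrow> (rat ^ 'n) set \<Rightarrow> real \<Rightarrow> bool"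
  where "adically_visible p rep c t \<longleftrightarrow>
    (\<exists>P. branch rep c t = int_vec P \<and>
      (\<forall>s Q. 0 < s \<and> s < t \<and> branch rep c s = int_vec Q \<longrightarrow> vec_val p P \<le> vec_val p Q))"

text \<open>
  The points of the branch locus at which a property of (branch, parameter) pairs holds.
  By \<open>ex1_branch_point\<close> below, the pair is determined by the point.
\<close>

definition points_where ::
    "(rat ^ 'n) set \<Rightarrow> ((rat ^ 'n) set \<Rightarrow> rat ^ 'n) \<Rightarrow>
      ((rat ^ 'n) set \<Rightarrow> real \<Rightarrow> bool) \<Rightarrow> (int ^ 'n) set"
  where "points_where V rep vis =
    {P \<in> branch_locus V.
      \<exists>(c, t) \<in> branch_points V rep. branch rep c t = int_vec P \<and> vis c t}"

definition proportion :: "(int ^ 'n::finite) set \<Rightarrow> (int ^ 'n) set \<Rightarrow> real \<Rightarrow> real"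
  where "proportion B S X =
    real (card {P \<in> B \<inter> S. real_of_int (height P) \<le> X}) /
    real (card {P \<in> B. real_of_int (height P) \<le> X})"

definition visible_proportion ::
    "(rat ^ 'n::finite) set \<Rightarrow> ((rat ^ 'n) set \<Rightarrow> rat ^ 'n) \<Rightarrow> real \<Rightarrow> real"
  where "visible_proportion V rep =
    proportion (branch_locus V) (points_where V rep (globally_visible rep))"

definition adically_visible_proportion ::
    "nat \<Rightarrow> (rat ^ 'n::finite) set \<Rightarrow> ((rat ^ 'n) set \<Rightarrow> rat ^ 'n) \<Rightarrow> real \<Rightarrow> real"
  where "adically_visible_proportion p V rep =
    proportion (branch_locus V) (points_where V rep (adically_visible p rep))"

text \<open>
  The densities are meaningful only when the limits exist; existence has to be stated
  separately.
\<close>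

definition visible_density ::
    "(rat ^ 'n::finite) set \<Rightarrow> ((rat ^ 'n) set \<Rightarrow> rat ^ 'n) \<Rightarrow> real"
  where "visible_density V rep = Lim at_top (visible_proportion V rep)"

definition adically_visible_density ::
    "nat \<Rightarrow> (rat ^ 'n::finite) set \<Rightarrow> ((rat ^ 'n) set \<Rightarrow> rat ^ 'n) \<Rightarrow> real"
  where "adically_visible_density p V rep = Lim at_top (adically_visible_proportion p V rep)"

definition pythagorean_cone :: "(rat ^ 3) set"
  where "pythagorean_cone = {v. (v $ 1)\<^sup>2 + (v $ 2)\<^sup>2 = (v $ 3)\<^sup>2}"


section \<open>Every point of the branch locus lies on exactly one branch, once\<close>

lemma equiv_ray_rel: "equiv (pos_points V) (ray_rel V)"
proof (rule equivI)
  show "ray_rel V \<subseteq> pos_points V \<times> pos_points V"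
    by (auto simp: ray_rel_def)
  show "refl_on (pos_points V) (ray_rel V)"
    by (auto simp: refl_on_def ray_rel_def intro!: exI[of _ 1])
  show "sym (ray_rel V)"
  proof (rule symI)
    fix v w assume "(v, w) \<in> ray_rel V"
    then obtain q where "v \<in> pos_points V" "w \<in> pos_points V" and q: "q > 0" "w = q *s v"
      by (auto simp: ray_rel_def)
    moreover have "v = inverse q *s w" "inverse q > 0"
      using q by (auto simp: vector_smult_assoc)
    ultimately show "(w, v) \<in> ray_rel V"
      unfolding ray_rel_def by blast
  qed
  show "trans (ray_rel V)"
  proof (rule transI)
    fix u v w assume "(u, v) \<in> ray_rel V" "(v, w) \<in> ray_rel V"
    then obtain q r where "u \<in> pos_points V" "w \<in> pos_points V"
      and q: "q > 0" "r > 0" "w = r *s (q *s u)"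
      by (auto simp: ray_rel_def)
    moreover have "w = (r * q) *s u" "r * q > 0"
      using q by (auto simp: vector_smult_assoc)
    ultimately show "(u, w) \<in> ray_rel V"
      unfolding ray_rel_def by blast
  qed
qed

lemma ex_ray_representatives: "\<exists>rep. ray_representatives V rep"
proof -
  have "\<forall>c \<in> ray_classes V. \<exists>v. v \<in> c"
    using in_quotient_imp_non_empty[OF equiv_ray_rel] by (fastforce simp: ray_classes_def)
  then show ?thesis
    unfolding ray_representatives_def by (rule bchoice)
qed

lemma ex1_branch_point:
  fixes V :: "(rat ^ 'n::finite) set"
  assumes rep: "ray_representatives V rep" and P: "P \<in> branch_locus V"
  shows "\<exists>!(c, t). (c, t) \<in> branch_points V rep \<and> branch rep c t = int_vec P"
proof -
  define v where "v = (int_vec P :: rat ^ 'n)"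
  define c where "c = ray_rel V `` {v}"
  have v_pos: "v \<in> pos_points V"
    using P by (auto simp: v_def branch_locus_def pos_points_def int_vec_def)
  have c_class: "c \<in> ray_classes V"
    using v_pos by (auto simp: c_def ray_classes_def intro: quotientI)
  have "rep c \<in> c"
    using rep c_class by (auto simp: ray_representatives_def)
  then have "(rep c, v) \<in> ray_rel V"
    using equiv_ray_rel[of V] unfolding c_def by (blast elim: equivE dest: symD)
  then obtain q where q: "q > 0" "v = q *s rep c"
    by (auto simp: ray_rel_def)
  have "branch rep c (of_rat q) = (int_vec P :: real ^ 'n)"
  proof (subst vec_eq_iff, rule allI)
    fix i
    have "of_int (P $ i) = q * rep c $ i"
      using q(2) by (simp add: v_def vec_eq_iff int_vec_def)
    then have "real_of_rat (of_int (P $ i)) = of_rat (q * rep c $ i)"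
      by simp
    then show "branch rep c (of_rat q) $ i = (int_vec P :: real ^ 'n) $ i"
      by (simp add: branch_def rat_vec_def int_vec_def of_rat_mult)
  qed
  then have ex: "(c, of_rat q) \<in> branch_points V rep \<and> branch rep c (of_rat q) = int_vec P"
    using c_class q P by (auto simp: branch_points_def)
  have uniq: "d = c \<and> t = of_rat q"
    if d: "d \<in> ray_classes V" and t: "0 < t" and eq: "branch rep d t = int_vec P" for d t
  proof -
    have rd: "rep d \<in> d"
      using rep d by (auto simp: ray_representatives_def)
    then have rp: "rep d \<in> pos_points V"
      using d equiv_ray_rel[of V] unfolding ray_classes_def by (metis in_quotient_imp_subset subsetD)
    have ti: "t * of_rat (rep d $ i) = of_int (P $ i)" for i
      using eq by (simp add: vec_eq_iff branch_def rat_vec_def int_vec_def)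
    define r where "r = of_int (P $ undefined) / rep d $ undefined"
    have pos: "rep d $ i > 0" for i
      using rp by (auto simp: pos_points_def)
    have tr: "t = of_rat r"
      using ti[of undefined] pos[of undefined]
      by (simp add: r_def of_rat_divide field_simps)
    have "r > 0"
      using t tr by simp
    moreover have "v = r *s rep d"
    proof (subst vec_eq_iff, rule allI)
      fix i
      have "real_of_rat (r * rep d $ i) = of_rat (of_int (P $ i))"
        using ti[of i] by (simp add: tr of_rat_mult)
      then show "v $ i = (r *s rep d) $ i"
        by (simp add: v_def int_vec_def del: of_rat_of_int_eq)
    qed
    ultimately have "(rep d, v) \<in> ray_rel V"
      using rp v_pos by (auto simp: ray_rel_def)
    then have dc: "d = c"
      using d rd equiv_ray_rel[of V] unfolding ray_classes_def c_def
      by (metis equiv_class_eq Image_singleton_iff quotientE)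
    have "of_rat q * real_of_rat (rep d $ undefined) = t * of_rat (rep d $ undefined)"
      using ex ti[of undefined] unfolding dc
      by (simp add: vec_eq_iff branch_def rat_vec_def int_vec_def)
    then have "t = of_rat q"
      using pos[of undefined] by simp
    with dc show ?thesis ..
  qed
  show ?thesis
  proof (rule ex1I[of _ "(c, of_rat q)"])
    show "case (c, of_rat q) of (c, t) \<Rightarrow> (c, t) \<in> branch_points V rep \<and> branch rep c t = int_vec P"
      using ex by simp
  next
    fix x assume "case x of (c, t) \<Rightarrow> (c, t) \<in> branch_points V rep \<and> branch rep c t = int_vec P"
    then show "x = (c, of_rat q)"
      using uniq by (cases x) (auto simp: branch_points_def)
  qed
qed

end

theory Submission
  imports Defs "HOL-Computational_Algebra.Nth_Powers"
begin

text \<open>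
  Write an integer point with positive coordinates as \<open>m\<close> times a primitive vector, where \<open>m\<close> is
  its content, the gcd of the coordinates. The integer points on its ray are the positive multiples
  of the primitive vector. Hence the point is globally visible iff \<open>m = 1\<close>
  (\<open>globally_visible_iff\<close>) and \<open>p\<close>-adically visible iff \<open>p\<close> does not divide \<open>m\<close>
  (\<open>adically_visible_iff\<close>). Local detectability is then the fact that a positive integer without
  prime divisors is \<open>1\<close>.

  For the densities, let \<open>A X\<close> and \<open>B X\<close> count the primitive and all triples of height at most
  \<open>X\<close>. Sorting by content gives \<open>B X = A X + A (X / 2) + A (X / 3) + \<dots>\<close>
  (\<open>count_branch_locus\<close>). For large \<open>X\<close>, Euclid's parametrization puts \<open>A X\<close> between two
  positive multiples of \<open>X\<close>: from above because a primitive triple is determined by two integers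
  of size at most \<open>sqrt (2 * X)\<close> and a factor \<open>1\<close> or \<open>2\<close>, from below because a positive proportion
  of the pairs of opposite parity is coprime. So \<open>B X / X\<close> grows at least like the harmonic sum, and \<open>A X / B X\<close> tends to \<open>0\<close>
  (\<open>primitive_triples_thin\<close>). This is the global density.

  The triples that are not \<open>p\<close>-adically visible number \<open>B (X / p)\<close>, the sum of the terms
  \<open>A (X / m)\<close> with \<open>p\<close> dividing \<open>m\<close>. Because these terms decrease in \<open>m\<close>, \<open>p * B (X / p)\<close> differs
  from \<open>B X\<close> by at most \<open>p * A X\<close> (\<open>count_multiples_bounds\<close>), which is negligible against \<open>B X\<close>.
  Thus the \<open>p\<close>-adic density \<open>1 - 1 / p\<close> is a consequence of the global density being \<open>0\<close>.

  The product formula amounts to \<open>\<Prod>p. 1 - 1 / p\<close> diverging to \<open>0\<close>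
  (\<open>euler_product_tendsto_0\<close>), which is Euler's argument from the divergence of the harmonic series.
\<close>

section \<open>Visibility in terms of the content\<close>

definition content :: "int ^ 'n::finite \<Rightarrow> int"
  where "content P = Gcd (range (\<lambda>i. P $ i))"

lemma content_dvd: "content P dvd P $ i"
  unfolding content_def by (rule Gcd_dvd) simp

lemma content_greatest: "(\<And>i. d dvd P $ i) \<Longrightarrow> d dvd content P"
  unfolding content_def by (rule Gcd_greatest) auto

lemma dvd_content_iff: "d dvd content P \<longleftrightarrow> (\<forall>i. d dvd P $ i)"
  by (meson content_dvd content_greatest dvd_trans)

lemma content_nonneg: "content P \<ge> 0"
  by (simp add: content_def)

lemma content_scale: "content (k *s P) = \<bar>k\<bar> * content P"
proof -
  have "range (\<lambda>i. (k *s P) $ i) = (*) k ` range (\<lambda>i. P $ i)"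
    by (simp add: image_image)
  then show ?thesis
    by (simp add: content_def Gcd_mult abs_mult)
qed

lemma content_pos: "\<forall>i. 0 < P $ i \<Longrightarrow> 0 < content P"
  by (metis content_dvd content_nonneg dvd_0_left_iff order_less_irrefl order_le_less)

lemma content_le: "0 < P $ i \<Longrightarrow> content P \<le> P $ i"
  by (simp add: content_dvd zdvd_imp_le)

lemma dvd_content_imp_scale:
  assumes "d dvd content P"
  obtains Q where "P = d *s Q"
proof
  show "P = d *s (\<chi> i. P $ i div d)"
    using assms by (simp add: vec_eq_iff dvd_content_iff)
qed

lemma int_vec_inject [simp]: "(int_vec P :: 'a::ring_char_0 ^ 'n) = int_vec Q \<longleftrightarrow> P = Q"
  by (simp add: int_vec_def vec_eq_iff)

text \<open>
  Two integer points on one branch differ by a factor \<open>s / t\<close> that is a priori only real. It is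
  the rational number \<open>b / a\<close> for any common coordinate, and clearing that denominator lets
  the homogeneity of the content carry the factor over.
\<close>

lemma content_along_branch:
  fixes rep :: "(rat ^ 'n::finite) set \<Rightarrow> rat ^ 'n"
  assumes P: "branch rep c t = int_vec P" "\<forall>i. 0 < P $ i" "0 < t"
    and Q: "branch rep c s = int_vec Q" "0 < s"
  shows "real_of_int (content Q) * t = s * real_of_int (content P)"
proof -
  have tv: "t * of_rat (rep c $ i) = real_of_int (P $ i)"
    and sv: "s * of_rat (rep c $ i) = real_of_int (Q $ i)" for i
    using P Q by (simp_all add: vec_eq_iff branch_def rat_vec_def int_vec_def)
  have scaled: "real_of_int (P $ i) * s = Q $ i * t" for i
    unfolding tv[symmetric] sv[symmetric] by simp
  (* The index type is inhabited, so an arbitrary coordinate can serve to measure the ratio. *)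
  define k :: 'n where "k = undefined"
  define a b where "a = P $ k" and "b = Q $ k"
  have a: "a > 0" using P by (simp add: a_def)
  have ab: "a * s = b * t"
    using scaled[of k] by (simp add: a_def b_def)
  then have "0 < b * t" using a Q by (metis mult_pos_pos of_int_0_less_iff)
  then have b: "b > 0" using P by (simp add: zero_less_mult_iff)
  have "a *s Q = b *s P"
  proof (subst vec_eq_iff, rule allI)
    fix i
    have "real_of_int (a * Q $ i) * t = P $ i * (a * s)"
      using scaled[of i] by (simp add: algebra_simps)
    also have "\<dots> = real_of_int (b * P $ i) * t"
      by (simp add: ab)
    finally have "real_of_int (a * Q $ i) = real_of_int (b * P $ i)"
      using P(3) by simp
    then show "(a *s Q) $ i = (b *s P) $ i"
      by (simp only: of_int_eq_iff vector_smult_component)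
  qed
  then have "content (a *s Q) = content (b *s P)" by simp
  then have "real_of_int (a * content Q) = real_of_int (b * content P)"
    using a b by (simp add: content_scale)
  then have "a * (content Q * t) = (b * t) * content P" by simp
  also have "\<dots> = a * (s * content P)" by (simp flip: ab)
  finally show ?thesis using a by simp
qed

lemma branch_divide:
  fixes rep :: "(rat ^ 'n::finite) set \<Rightarrow> rat ^ 'n"
  assumes "branch rep c t = int_vec (m *s P)" "m > 0"
  shows "branch rep c (t / m) = int_vec P"
  using assms by (simp add: vec_eq_iff branch_def int_vec_def field_simps)

text \<open>
  The integer points on the ray through \<open>P\<close> are the positive multiples of the primitive point
  \<open>P / content P\<close>, and \<open>P\<close> is the first of them exactly when it is that primitive point.
\<close>

lemma globally_visible_iff:
  fixes rep :: "(rat ^ 'n::finite) set \<Rightarrow> rat ^ 'n"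
  assumes P: "branch rep c t = int_vec P" "\<forall>i. 0 < P $ i" "0 < t"
  shows "globally_visible rep c t \<longleftrightarrow> content P = 1"
proof
  assume vis: "globally_visible rep c t"
  obtain Q where Q: "P = content P *s Q"
    using dvd_content_imp_scale[OF dvd_refl] .
  have "branch rep c (t / content P) = int_vec Q"
    using P Q content_pos[OF P(2)] by (intro branch_divide) simp_all
  then have "\<not> t / content P < t"
    using vis content_pos[OF P(2)] P(3) unfolding globally_visible_def
    by (metis divide_pos_pos of_int_0_less_iff rangeI)
  then show "content P = 1"
    using content_pos[OF P(2)] P(3) by (simp add: field_simps)
next
  assume one: "content P = 1"
  show "globally_visible rep c t"
    unfolding globally_visible_def
  proof clarify
    fix s Q assume s: "0 < s" "s < t" and Q: "branch rep c s = int_vec Q"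
    have eq: "content Q * t = s"
      using content_along_branch[OF P Q s(1)] one by simp
    then have "0 < content Q"
      using s P(3) by (simp add: zero_less_mult_iff flip: eq)
    then have "t \<le> content Q * t" using P(3) by simp
    then show False using eq s by simp
  qed
qed

lemma vec_val_eq_0_iff:
  assumes "prime p"
  shows "vec_val p P = 0 \<longleftrightarrow> \<not> int p dvd content P"
proof -
  have "int_val p a = 0 \<longleftrightarrow> \<not> int p dvd a" for a
    using assms by (auto simp: int_val_def prime_elem_multiplicity_eq_zero_iff zero_enat_def)
  moreover have "vec_val p P = 0 \<longleftrightarrow> (\<exists>i. int_val p (P $ i) = 0)"
  proof
    assume "vec_val p P = 0"
    moreover have "vec_val p P \<in> range (\<lambda>i. int_val p (P $ i))"
      unfolding vec_val_def by (rule Min_in) auto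
    ultimately show "\<exists>i. int_val p (P $ i) = 0" by auto
  next
    assume "\<exists>i. int_val p (P $ i) = 0"
    then obtain i where "int_val p (P $ i) = 0" by blast
    moreover have "vec_val p P \<le> int_val p (P $ i)"
      unfolding vec_val_def by (rule Min_le) auto
    ultimately show "vec_val p P = 0" by simp
  qed
  ultimately show ?thesis by (simp add: dvd_content_iff)
qed

text \<open>
  Only the primitive point of the ray matters: its valuation is \<open>0\<close>, so a later point \<open>P\<close>
  satisfies the valuation inequality against it precisely when \<open>P\<close> has valuation \<open>0\<close> itself,
  and then the inequality against all earlier points is automatic.
\<close>

lemma adically_visible_iff:
  fixes rep :: "(rat ^ 'n::finite) set \<Rightarrow> rat ^ 'n"
  assumes P: "branch rep c t = int_vec P" "\<forall>i. 0 < P $ i" "0 < t" and p: "prime p"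
  shows "adically_visible p rep c t \<longleftrightarrow> \<not> int p dvd content P"
proof
  assume "adically_visible p rep c t"
  then have vis: "vec_val p P \<le> vec_val p Q"
    if "0 < s" "s < t" "branch rep c s = int_vec Q" for s Q
    using that P(1) unfolding adically_visible_def by auto
  show "\<not> int p dvd content P"
  proof
    assume dvd: "int p dvd content P"
    have pos: "content P > 0" by (rule content_pos[OF P(2)])
    have one: "content P > 1"
      using dvd pos p by (metis not_prime_unit order_le_less zless_imp_add1_zle add_0 prime_nat_int_transfer)
    (* Since p divides the content, the primitive point lies strictly before P. *)
    obtain Q where Q: "P = content P *s Q"
      using dvd_content_imp_scale[OF dvd_refl] .
    have "content P = content P * content Q"
      using Q content_scale[of "content P" Q] pos by simp
    then have "content Q = 1" using pos by simp
    then have "vec_val p Q = 0"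
      using p prime_gt_1_nat[OF p] by (simp add: vec_val_eq_0_iff)
    moreover have "branch rep c (t / content P) = int_vec Q"
      using P Q pos by (intro branch_divide) simp_all
    moreover have "0 < t / content P" "t / content P < t"
      using P(3) one by (simp_all add: field_simps)
    ultimately have "vec_val p P = 0" using vis by force
    then show False using dvd p by (simp add: vec_val_eq_0_iff)
  qed
next
  assume "\<not> int p dvd content P"
  then have "vec_val p P = 0" using p by (simp add: vec_val_eq_0_iff)
  then show "adically_visible p rep c t"
    using P(1) by (auto simp: adically_visible_def)
qed

lemma branch_pointE:
  assumes "(c, t) \<in> branch_points V rep"
  obtains P where "P \<in> branch_locus V" "branch rep c t = int_vec P" "\<forall>i. 0 < P $ i" "0 < t"
  using assms by (auto simp: branch_points_def branch_locus_def)

text \<open>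
  Local detectability, for every variety: the content equals \<open>1\<close> if and only if no prime
  divides it.
\<close>

lemma globally_visible_iff_adically_visible:
  fixes rep :: "(rat ^ 'n::finite) set \<Rightarrow> rat ^ 'n"
  assumes "(c, t) \<in> branch_points V rep"
  shows "globally_visible rep c t \<longleftrightarrow> (\<forall>p. prime p \<longrightarrow> adically_visible p rep c t)"
proof -
  obtain P where P: "branch rep c t = int_vec P" "\<forall>i. 0 < P $ i" "0 < t"
    using assms by (rule branch_pointE)
  have "content P = 1 \<longleftrightarrow> (\<forall>p. prime p \<longrightarrow> \<not> int p dvd content P)"
  proof
    assume "content P = 1"
    then show "\<forall>p. prime p \<longrightarrow> \<not> int p dvd content P" by auto
  next
    assume no: "\<forall>p. prime p \<longrightarrow> \<not> int p dvd content P"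
    have pos: "content P > 0" by (rule content_pos[OF P(2)])
    show "content P = 1"
    proof (rule ccontr)
      assume "content P \<noteq> 1"
      then have "nat (content P) \<noteq> 1" using pos by simp
      then obtain p where "prime p" "p dvd nat (content P)"
        using prime_factor_nat by blast
      then show False using no pos by (auto simp: int_dvd_int_iff[symmetric] simp del: int_dvd_int_iff)
    qed
  qed
  then show ?thesis
    by (simp add: globally_visible_iff[OF P] adically_visible_iff[OF P])
qed

text \<open>
  Translates a visibility notion that depends only on the integer point reached into a subset of
  the branch locus; every point of the locus is reached because representatives exist.
\<close>

lemma points_where_eq:
  fixes V :: "(rat ^ 'n::finite) set"
  assumes rep: "ray_representatives V rep"
    and vis: "\<And>c t P. branch rep c t = int_vec P \<Longrightarrow> \<forall>i. 0 < P $ i \<Longrightarrow> 0 < t \<Longrightarrow> vis c t \<longleftrightarrow> R P"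
  shows "points_where V rep vis = {P \<in> branch_locus V. R P}"
  unfolding points_where_def
proof (rule Collect_cong, rule conj_cong[OF refl])
  fix P assume P: "P \<in> branch_locus V"
  obtain c t where ct: "(c, t) \<in> branch_points V rep" "branch rep c t = int_vec P"
    using ex1_branch_point[OF rep P] by blast
  have "vis d s \<longleftrightarrow> R P"
    if "(d, s) \<in> branch_points V rep" "branch rep d s = int_vec P" for d s
    using that P by (intro vis) (auto simp: branch_points_def branch_locus_def)
  then show "(\<exists>(c, t) \<in> branch_points V rep. branch rep c t = int_vec P \<and> vis c t) \<longleftrightarrow> R P"
    using ct by auto
qed

section \<open>Counting points by their content\<close>

definition count_upto :: "(int ^ 'n::finite) set \<Rightarrow> real \<Rightarrow> nat"
  where "count_upto S X = card {P \<in> S. real_of_int (height P) \<le> X}"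

definition primitive_points :: "(rat ^ 'n::finite) set \<Rightarrow> (int ^ 'n) set"
  where "primitive_points V = {P \<in> branch_locus V. content P = 1}"

lemma height_le_iff: "real_of_int (height P) \<le> X \<longleftrightarrow> (\<forall>i. real_of_int \<bar>P $ i\<bar> \<le> X)"
proof -
  have "real_of_int (height P) \<le> X \<longleftrightarrow> height P \<le> \<lfloor>X\<rfloor>"
    by (simp add: le_floor_iff)
  also have "\<dots> \<longleftrightarrow> (\<forall>i. \<bar>P $ i\<bar> \<le> \<lfloor>X\<rfloor>)"
    by (simp add: height_def)
  also have "\<dots> \<longleftrightarrow> (\<forall>i. real_of_int \<bar>P $ i\<bar> \<le> X)"
    by (simp only: le_floor_iff)
  finally show ?thesis .
qed

lemma height_scale_le_iff:
  assumes "m > 0"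
  shows "real_of_int (height (int m *s P)) \<le> X \<longleftrightarrow> real_of_int (height P) \<le> X / real m"
  using assms by (simp add: height_le_iff abs_mult field_simps)

lemma finite_height_le: "finite {P :: int ^ 'n::finite. real_of_int (height P) \<le> X}"
proof (rule finite_subset)
  show "{P :: int ^ 'n. real_of_int (height P) \<le> X} \<subseteq>
      vec_lambda ` (PiE UNIV (\<lambda>_. {- \<lfloor>X\<rfloor>..\<lfloor>X\<rfloor>}))"
  proof
    fix P :: "int ^ 'n" assume "P \<in> {P. real_of_int (height P) \<le> X}"
    then have "\<bar>P $ i\<bar> \<le> \<lfloor>X\<rfloor>" for i
      by (simp add: height_le_iff le_floor_iff)
    then have "vec_nth P \<in> PiE UNIV (\<lambda>_. {- \<lfloor>X\<rfloor>..\<lfloor>X\<rfloor>})"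
      by (auto simp: abs_le_iff minus_le_iff)
    then show "P \<in> vec_lambda ` (PiE UNIV (\<lambda>_. {- \<lfloor>X\<rfloor>..\<lfloor>X\<rfloor>}))"
      by (metis imageI vec_nth_inverse)
  qed
  show "finite (vec_lambda ` (PiE UNIV (\<lambda>_::'n. {- \<lfloor>X\<rfloor>..\<lfloor>X\<rfloor>})))"
    by (intro finite_imageI finite_PiE) auto
qed

lemma finite_points_upto: "finite {P \<in> S. real_of_int (height (P :: int ^ 'n::finite)) \<le> X}"
  by (rule finite_subset[OF _ finite_height_le[of X]]) auto

lemma count_upto_mono: "X \<le> Y \<Longrightarrow> count_upto S X \<le> count_upto S Y"
  unfolding count_upto_def by (rule card_mono[OF finite_points_upto]) auto

lemma inj_scale: "m > 0 \<Longrightarrow> inj_on (\<lambda>P :: int ^ 'n::finite. int m *s P) A"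
  by (auto simp: inj_on_def vec_eq_iff)

lemma count_upto_scale_image:
  assumes "m > 0"
  shows "count_upto ((\<lambda>P. int m *s P) ` S) X = count_upto S (X / real m)"
proof -
  have "{P \<in> (\<lambda>P. int m *s P) ` S. real_of_int (height P) \<le> X}
      = (\<lambda>P. int m *s P) ` {P \<in> S. real_of_int (height P) \<le> X / real m}"
    using height_scale_le_iff[OF assms] by auto
  then show ?thesis
    by (simp add: count_upto_def card_image[OF inj_scale[OF assms]])
qed

text \<open>
  What homogeneity of a variety gives for its set of rational points.
\<close>

definition scaling_closed :: "(rat ^ 'n) set \<Rightarrow> bool"
  where "scaling_closed V \<longleftrightarrow> (\<forall>q>0. \<forall>v\<in>V. q *s v \<in> V)"

lemma branch_locus_scale_iff:
  fixes V :: "(rat ^ 'n::finite) set"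
  assumes V: "scaling_closed V" and m: "m > 0"
  shows "int m *s P \<in> branch_locus V \<longleftrightarrow> P \<in> branch_locus V"
proof -
  have closed: "q *s v \<in> V" if "q > 0" "v \<in> V" for q v
    using V that by (simp add: scaling_closed_def)
  have scale: "int_vec (int m *s P) = of_nat m *s (int_vec P :: rat ^ 'n)"
    by (simp add: int_vec_def vec_eq_iff)
  have "(of_nat m *s (int_vec P :: rat ^ 'n)) \<in> V \<longleftrightarrow> int_vec P \<in> V"
  proof
    assume "of_nat m *s (int_vec P :: rat ^ 'n) \<in> V"
    then have "inverse (of_nat m) *s (of_nat m *s (int_vec P :: rat ^ 'n)) \<in> V"
      by (rule closed[rotated]) (simp add: m)
    moreover have "inverse (of_nat m) *s (of_nat m *s (int_vec P :: rat ^ 'n)) = int_vec P"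
      using m by (simp add: vec_eq_iff)
    ultimately show "int_vec P \<in> V" by simp
  next
    assume "int_vec P \<in> V"
    then show "of_nat m *s (int_vec P :: rat ^ 'n) \<in> V"
      using m by (intro closed) simp_all
  qed
  then show ?thesis
    using m by (auto simp: branch_locus_def scale zero_less_mult_iff)
qed

lemma branch_locus_dvd_content:
  fixes V :: "(rat ^ 'n::finite) set"
  assumes V: "scaling_closed V" and m: "m > 0"
  shows "{P \<in> branch_locus V. int m dvd content P} = (\<lambda>P. int m *s P) ` branch_locus V"
proof (intro equalityI subsetI)
  fix P assume "P \<in> {P \<in> branch_locus V. int m dvd content P}"
  then obtain Q where "P = int m *s Q" "P \<in> branch_locus V"
    using dvd_content_imp_scale by blast
  then show "P \<in> (\<lambda>P. int m *s P) ` branch_locus V"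
    using branch_locus_scale_iff[OF V m] by auto
next
  fix P assume "P \<in> (\<lambda>P. int m *s P) ` branch_locus V"
  then show "P \<in> {P \<in> branch_locus V. int m dvd content P}"
    using branch_locus_scale_iff[OF V m] by (auto simp: content_scale)
qed

lemma branch_locus_content_eq:
  fixes V :: "(rat ^ 'n::finite) set"
  assumes V: "scaling_closed V" and m: "m > 0"
  shows "{P \<in> branch_locus V. content P = int m} = (\<lambda>P. int m *s P) ` primitive_points V"
proof (intro equalityI subsetI)
  fix P assume P: "P \<in> {P \<in> branch_locus V. content P = int m}"
  then have "int m dvd content P" by simp
  then obtain Q where Q: "P = int m *s Q"
    using dvd_content_imp_scale by blast
  then show "P \<in> (\<lambda>P. int m *s P) ` primitive_points V"
    using P m branch_locus_scale_iff[OF V m] by (auto simp: primitive_points_def content_scale)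
next
  fix P assume "P \<in> (\<lambda>P. int m *s P) ` primitive_points V"
  then show "P \<in> {P \<in> branch_locus V. content P = int m}"
    using branch_locus_scale_iff[OF V m] by (auto simp: primitive_points_def content_scale)
qed

lemma content_le_height:
  assumes "\<forall>i. 0 < P $ i"
  shows "content P \<le> height (P :: int ^ 'n::finite)"
proof -
  have "content P \<le> P $ undefined" using assms by (intro content_le) simp
  also have "\<dots> \<le> \<bar>P $ undefined\<bar>" by simp
  also have "\<dots> \<le> height P" unfolding height_def by (rule Max_ge) auto
  finally show ?thesis .
qed

text \<open>
  Sorting the points by their content: the points of content \<open>m\<close> are \<open>m\<close> times the primitive
  points. The sum may stop at any \<open>K\<close> with \<open>X \<le> K\<close>, since the content is at most the height.
\<close>

lemma count_branch_locus:
  fixes V :: "(rat ^ 'n::finite) set"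
  assumes V: "scaling_closed V" and X: "X \<le> real K"
  shows "count_upto (branch_locus V) X = (\<Sum>m=1..K. count_upto (primitive_points V) (X / real m))"
proof -
  define L where "L m = {P \<in> branch_locus V. content P = int m}" for m
  have level: "card {P \<in> L m. real_of_int (height P) \<le> X} = count_upto (primitive_points V) (X / real m)"
    if "m \<in> {1..K}" for m
    using that count_upto_scale_image[of m "primitive_points V" X]
    by (simp add: L_def branch_locus_content_eq[OF V] count_upto_def)
  have "{P \<in> branch_locus V. real_of_int (height P) \<le> X}
      = (\<Union>m\<in>{1..K}. {P \<in> L m. real_of_int (height P) \<le> X})"
  proof (intro equalityI subsetI)
    fix P assume P: "P \<in> {P \<in> branch_locus V. real_of_int (height P) \<le> X}"
    then have pos: "\<forall>i. 0 < P $ i" by (simp add: branch_locus_def)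
    have "real_of_int (content P) \<le> real K"
    proof -
      have "real_of_int (content P) \<le> real_of_int (height P)"
        using content_le_height[OF pos] by (simp only: of_int_le_iff)
      also have "\<dots> \<le> X" using P by simp
      finally show ?thesis using X by simp
    qed
    then have "nat (content P) \<in> {1..K}"
      using content_pos[OF pos] by auto
    moreover have "P \<in> L (nat (content P))"
      using P content_nonneg[of P] by (simp add: L_def)
    ultimately show "P \<in> (\<Union>m\<in>{1..K}. {P \<in> L m. real_of_int (height P) \<le> X})"
      using P by blast
  qed (auto simp: L_def)
  then have "count_upto (branch_locus V) X = card (\<Union>m\<in>{1..K}. {P \<in> L m. real_of_int (height P) \<le> X})"
    by (simp add: count_upto_def)
  also have "\<dots> = (\<Sum>m=1..K. card {P \<in> L m. real_of_int (height P) \<le> X})"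
    by (rule card_UN_disjoint) (simp_all add: finite_points_upto, auto simp: L_def)
  finally show ?thesis using level by simp
qed

text \<open>
  A truncated form of the decomposition by content that holds for every number \<open>M\<close> of terms,
  so that \<open>M\<close> can stay fixed while \<open>X\<close> grows.
\<close>

lemma sum_primitive_le_count:
  fixes V :: "(rat ^ 'n::finite) set"
  assumes V: "scaling_closed V"
  shows "(\<Sum>m=1..M. count_upto (primitive_points V) (X / real m)) \<le> count_upto (branch_locus V) X"
proof -
  obtain K where K: "X \<le> real K" using real_arch_simple by blast
  have "(\<Sum>m=1..M. count_upto (primitive_points V) (X / real m))
      \<le> (\<Sum>m=1..max K M. count_upto (primitive_points V) (X / real m))"
    by (rule sum_mono2) auto
  also have "\<dots> = count_upto (branch_locus V) X"
    using K by (intro count_branch_locus[OF V, symmetric]) simp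
  finally show ?thesis .
qed

text \<open>
  Each block of \<open>p\<close> consecutive indices after \<open>p * K\<close> has its values between \<open>f (p * Suc K)\<close> and
  \<open>f (p * K)\<close>. Thus sampling a decreasing sequence at the multiples of \<open>p\<close> recovers its whole sum,
  up to the factor \<open>p\<close> and one boundary term.
\<close>

lemma antimono_sum_multiples:
  fixes f :: "nat \<Rightarrow> nat"
  assumes f: "antimono f"
  shows "p * (\<Sum>j=1..K. f (p * j)) \<le> (\<Sum>m=1..p * K. f m)"
    and "(\<Sum>m=1..p * K. f m) \<le> p * (\<Sum>j<K. f (p * j))"
proof -
  have split: "(\<Sum>m=1..p * Suc K. f m) = (\<Sum>m=1..p * K. f m) + (\<Sum>m=p*K+1..p*K+p. f m)" for K
    using sum.ub_add_nat[of 1 "p * K" f p] by (simp add: add.commute)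
  have block_ge: "p * f (p * Suc K) \<le> (\<Sum>m=p*K+1..p*K+p. f m)" for K
  proof -
    have "f (p * Suc K) \<le> f m" if "m \<in> {p*K+1..p*K+p}" for m
      using that by (intro antimonoD[OF f]) simp
    from sum_bounded_below[of "{p*K+1..p*K+p}" "f (p * Suc K)" f, OF this] show ?thesis by simp
  qed
  have block_le: "(\<Sum>m=p*K+1..p*K+p. f m) \<le> p * f (p * K)" for K
  proof -
    have "f m \<le> f (p * K)" if "m \<in> {p*K+1..p*K+p}" for m
      using that by (intro antimonoD[OF f]) simp
    from sum_bounded_above[of "{p*K+1..p*K+p}" f "f (p * K)", OF this] show ?thesis by simp
  qed
  show "p * (\<Sum>j=1..K. f (p * j)) \<le> (\<Sum>m=1..p * K. f m)"
  proof (induction K)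
    case (Suc K)
    then show ?case using split[of K] block_ge[of K] by (simp add: distrib_left)
  qed simp
  show "(\<Sum>m=1..p * K. f m) \<le> p * (\<Sum>j<K. f (p * j))"
  proof (induction K)
    case (Suc K)
    then show ?case using split[of K] block_le[of K] by (simp add: distrib_left)
  qed simp
qed

text \<open>
  The points divisible by \<open>p\<close> number \<open>B (X / p)\<close>, which is the part of the decomposition of \<open>B X\<close>
  with index \<open>m\<close> divisible by \<open>p\<close>. As the terms \<open>A (X / m)\<close> decrease in \<open>m\<close>, this part is a \<open>p\<close>-th of the
  total up to \<open>A X\<close>.
\<close>

lemma count_multiples_bounds:
  fixes V :: "(rat ^ 'n::finite) set"
  assumes V: "scaling_closed V" and p: "p > 0" and X: "X \<ge> 0"
  defines "A \<equiv> count_upto (primitive_points V)" and "B \<equiv> count_upto (branch_locus V)"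
  shows "p * B (X / p) \<le> B X" and "B X \<le> p * B (X / p) + p * A X"
proof -
  (* The index 0 gets the value at 1, the largest term: it bounds the first block of the sum. *)
  define f where "f m = A (X / max 1 (real m))" for m
  have f: "antimono f"
    unfolding f_def A_def using X
    by (intro antimonoI count_upto_mono divide_left_mono) auto
  have f_pos: "f m = A (X / real m)" if "m \<ge> 1" for m
    using that by (simp add: f_def max_def)
  obtain K where K: "X \<le> real K" using real_arch_simple by blast
  have "K \<le> p * K" using p by simp
  then have pK: "X \<le> real (p * K)" using K by (meson order_trans of_nat_le_iff)
  then have "X / p \<le> K" using p by (simp add: field_simps)
  then have BXp: "B (X / p) = (\<Sum>j=1..K. f (p * j))"
    using p by (simp add: B_def A_def count_branch_locus[OF V] f_pos[unfolded A_def] mult.commute)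
  have BX: "B X = (\<Sum>m=1..p*K. f m)"
  proof -
    have "B X = (\<Sum>m=1..p*K. A (X / real m))"
      unfolding A_def B_def by (rule count_branch_locus[OF V pK])
    also have "\<dots> = (\<Sum>m=1..p*K. f m)"
      by (intro sum.cong) (simp_all add: f_pos)
    finally show ?thesis .
  qed
  show "p * B (X / p) \<le> B X"
    unfolding BX BXp by (rule antimono_sum_multiples[OF f])
  have "(\<Sum>j<K. f (p * j)) \<le> f 0 + (\<Sum>j=1..K. f (p * j))"
  proof -
    have "(\<Sum>j<K. f (p * j)) \<le> (\<Sum>j\<in>insert 0 {1..K}. f (p * j))"
      by (rule sum_mono2) auto
    then show ?thesis by simp
  qed
  then have "p * (\<Sum>j<K. f (p * j)) \<le> p * (A X + B (X / p))"
    by (simp add: BXp f_def)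
  then show "B X \<le> p * B (X / p) + p * A X"
    using antimono_sum_multiples(2)[OF f, of p K] by (simp add: BX distrib_left)
qed

text \<open>
  Dividing the bounds of \<open>count_multiples_bounds\<close> by \<open>p * B X\<close> squeezes \<open>B (X / p) / B X\<close> between
  \<open>1 / p - A X / B X\<close> and \<open>1 / p\<close>; so the \<open>p\<close>-adic density takes its expected value whenever
  primitive points have density \<open>0\<close>.
\<close>

lemma adic_proportion_tendsto:
  fixes V :: "(rat ^ 'n::finite) set"
  assumes V: "scaling_closed V" and p: "p > 0"
    and thin: "((\<lambda>X. real (count_upto (primitive_points V) X) / real (count_upto (branch_locus V) X)) \<longlongrightarrow> 0) at_top"
    and ne: "eventually (\<lambda>X. count_upto (branch_locus V) X > 0) at_top"
  shows "(proportion (branch_locus V) {P \<in> branch_locus V. \<not> int p dvd content P}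
      \<longlongrightarrow> 1 - 1 / real p) at_top"
proof -
  define A where "A = count_upto (primitive_points V)"
  define B where "B = count_upto (branch_locus V)"
  have eq: "proportion (branch_locus V) {P \<in> branch_locus V. \<not> int p dvd content P} X
      = 1 - B (X / p) / B X" if "B X > 0" for X
  proof -
    let ?H = "\<lambda>S. {P \<in> S. real_of_int (height P) \<le> X}"
    let ?D = "{P \<in> branch_locus V. int p dvd content P}"
    have "{P \<in> branch_locus V \<inter> {P \<in> branch_locus V. \<not> int p dvd content P}. real_of_int (height P) \<le> X}
        = ?H (branch_locus V) - ?H ?D" by auto
    moreover have "card (?H (branch_locus V) - ?H ?D) = card (?H (branch_locus V)) - card (?H ?D)"
      by (rule card_Diff_subset[OF finite_points_upto]) auto
    moreover have "card (?H ?D) \<le> card (?H (branch_locus V))"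
      by (rule card_mono[OF finite_points_upto]) auto
    moreover have "card (?H ?D) = B (X / p)"
      using count_upto_scale_image[OF p, of "branch_locus V" X]
      by (simp add: branch_locus_dvd_content[OF V p] B_def count_upto_def)
    moreover have "card (?H (branch_locus V)) = B X" by (simp add: B_def count_upto_def)
    ultimately show ?thesis
      using that by (simp add: proportion_def of_nat_diff diff_divide_distrib)
  qed
  have "((\<lambda>X. B (X / p) / B X) \<longlongrightarrow> 1 / real p) at_top"
  proof (rule tendsto_sandwich)
    show "((\<lambda>X. 1 / real p - A X / B X) \<longlongrightarrow> 1 / real p) at_top"
      using tendsto_diff[OF tendsto_const thin, of "1 / real p"] by (simp add: A_def B_def)
    show "\<forall>\<^sub>F X in at_top. 1 / real p - A X / B X \<le> B (X / p) / B X"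
      using ne eventually_ge_at_top[of 0]
    proof eventually_elim
      case (elim X)
      then have "real (B X) \<le> real (p * B (X / p) + p * A X)"
        using count_multiples_bounds(2)[OF V p] unfolding A_def B_def by (simp only: of_nat_le_iff)
      then have "B X / (p * B X) \<le> (p * B (X / p) + p * A X) / (p * B X)"
        by (intro divide_right_mono) simp_all
      also have "\<dots> = B (X / p) / B X + A X / B X"
        using p by (simp add: add_divide_distrib)
      finally show ?case using elim(1) by (simp add: B_def)
    qed
    show "\<forall>\<^sub>F X in at_top. B (X / p) / B X \<le> 1 / real p"
      using ne eventually_ge_at_top[of 0]
    proof eventually_elim
      case (elim X)
      then have "real (p * B (X / p)) \<le> real (B X)"
        using count_multiples_bounds(1)[OF V p] unfolding B_def by (simp only: of_nat_le_iff)
      then show ?case using elim p by (simp add: B_def field_simps)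
    qed
  qed simp
  then have "((\<lambda>X. 1 - B (X / p) / B X) \<longlongrightarrow> 1 - 1 / real p) at_top"
    by (intro tendsto_diff tendsto_const)
  then show ?thesis
    by (rule Lim_transform_eventually) (use ne in \<open>eventually_elim, simp add: eq B_def\<close>)
qed

lemma global_proportion_eq:
  "proportion (branch_locus V) {P \<in> branch_locus V. content P = 1} X
    = count_upto (primitive_points V) X / count_upto (branch_locus V) X"
proof -
  have "branch_locus V \<inter> {P \<in> branch_locus V. content P = 1} = primitive_points V"
    by (auto simp: primitive_points_def)
  then show ?thesis by (simp only: proportion_def count_upto_def)
qed

section \<open>Primitive Pythagorean triples grow at most linearly\<close>

lemma scaling_closed_pythagorean: "scaling_closed pythagorean_cone"
  by (auto simp: scaling_closed_def pythagorean_cone_def power_mult_distrib simp flip: distrib_left)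

lemma pythagorean_branch_locus_iff:
  "P \<in> branch_locus pythagorean_cone \<longleftrightarrow>
    (P $ 1)\<^sup>2 + (P $ 2)\<^sup>2 = (P $ 3)\<^sup>2 \<and> 0 < P $ 1 \<and> 0 < P $ 2 \<and> 0 < P $ 3"
proof -
  have "(of_int (P $ 1))\<^sup>2 + (of_int (P $ 2))\<^sup>2 = (of_int (P $ 3) :: rat)\<^sup>2 \<longleftrightarrow>
      (P $ 1)\<^sup>2 + (P $ 2)\<^sup>2 = (P $ 3)\<^sup>2"
    by (simp only: of_int_eq_iff flip: of_int_power of_int_add)
  then show ?thesis
    by (simp add: branch_locus_def pythagorean_cone_def int_vec_def forall_3)
qed

lemma pythagorean_height_le_iff:
  assumes "P \<in> branch_locus pythagorean_cone"
  shows "real_of_int (height P) \<le> X \<longleftrightarrow> real_of_int (P $ 3) \<le> X"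
proof -
  have *: "(P $ 1)\<^sup>2 + (P $ 2)\<^sup>2 = (P $ 3)\<^sup>2" "0 < P $ 1" "0 < P $ 2" "0 < P $ 3"
    using assms by (simp_all add: pythagorean_branch_locus_iff)
  have "(P $ 1)\<^sup>2 \<le> (P $ 3)\<^sup>2" "(P $ 2)\<^sup>2 \<le> (P $ 3)\<^sup>2"
    by (simp_all flip: *(1))
  then have "P $ 1 \<le> P $ 3" "P $ 2 \<le> P $ 3"
    using * by (auto intro: power2_le_imp_le)
  then have "real_of_int (P $ 1) \<le> P $ 3" "real_of_int (P $ 2) \<le> P $ 3" by simp_all
  then show ?thesis
    using * by (auto simp: height_le_iff forall_3)
qed

lemma int_coprime_mult_eq_square:
  fixes r s w :: int
  assumes "coprime r s" "r * s = w\<^sup>2" "0 < r" "0 < s"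
  obtains a b where "r = a\<^sup>2" "s = b\<^sup>2" "0 < a" "0 < b"
proof -
  have "coprime (nat r) (nat s)"
    using assms by (simp add: coprime_int_iff[symmetric])
  moreover have "nat r * nat s = (nat \<bar>w\<bar>)\<^sup>2"
    using assms by (simp add: nat_mult_distrib[symmetric] nat_power_eq[symmetric])
  ultimately have "is_nth_power 2 (nat r)" "is_nth_power 2 (nat s)"
    using is_nth_power_mult_coprime_nat_iff[of "nat r" "nat s" 2] by (metis is_nth_power_nth_power)+
  then obtain a b where ab: "nat r = a\<^sup>2" "nat s = b\<^sup>2"
    by (auto simp: is_nth_power_def)
  then have "r = (int a)\<^sup>2" "s = (int b)\<^sup>2"
    using assms by (metis int_nat_eq less_imp_le of_nat_power)+
  then show ?thesis
    using that[of "int a" "int b"] assms by (auto simp: zero_less_power2)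
qed

text \<open>
  Euclid's parametrization, without a case distinction on the parities of the legs: in
  \<open>y\<^sup>2 = (z - x) * (z + x)\<close> the gcd \<open>g\<close> of the two factors divides \<open>2\<close>, and after division by \<open>g\<close> the
  factors are coprime with square product, hence squares.
\<close>

lemma primitive_triple_parametrization:
  assumes "P \<in> primitive_points pythagorean_cone"
  obtains g a b :: int where "g \<in> {1, 2}" "0 < a" "0 < b"
    "P $ 3 - P $ 1 = g * a\<^sup>2" "P $ 3 + P $ 1 = g * b\<^sup>2" "P $ 2 = g * a * b"
proof -
  define x y z where "x = P $ 1" and "y = P $ 2" and "z = P $ 3"
  have xyz: "x\<^sup>2 + y\<^sup>2 = z\<^sup>2" "0 < x" "0 < y" "0 < z" and prim: "content P = 1"
    using assms by (simp_all add: primitive_points_def pythagorean_branch_locus_iff x_def y_def z_def)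
  have "x\<^sup>2 < z\<^sup>2" using xyz zero_less_power[of y 2] by linarith
  then have "x < z" using xyz by (auto intro: power2_less_imp_less)
  have cop: "coprime x z"
  proof (rule coprimeI)
    fix d assume d: "d dvd x" "d dvd z"
    then have "d\<^sup>2 dvd z\<^sup>2 - x\<^sup>2" by (intro dvd_diff) simp_all
    moreover have "z\<^sup>2 - x\<^sup>2 = y\<^sup>2" using xyz(1) by linarith
    ultimately have "d\<^sup>2 dvd y\<^sup>2" by (simp only:)
    then have "d dvd y" by simp
    then have "d dvd content P" using d by (simp add: dvd_content_iff forall_3 x_def y_def z_def)
    then show "is_unit d" using prim by simp
  qed
  define g where "g = gcd (z - x) (z + x)"
  have "g dvd (z + x) - (z - x)" "g dvd (z + x) + (z - x)"
    unfolding g_def by (intro dvd_diff dvd_add gcd_dvd1 gcd_dvd2)+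
  then have "g dvd gcd (2 * x) (2 * z)" by simp
  also have "gcd (2 * x) (2 * z) = 2"
    using cop by (simp add: gcd_mult_left)
  finally have "g \<le> 2" by (rule zdvd_imp_le) simp
  moreover have "g > 0" using xyz by (simp add: g_def)
  ultimately have g: "g \<in> {1, 2}" by auto
  obtain r s where rs: "z - x = r * g" "z + x = s * g" "coprime r s"
    using gcd_coprime_exists[of "z - x" "z + x"] \<open>g > 0\<close> unfolding g_def by auto
  have rs_pos: "0 < r" "0 < s"
    using rs \<open>x < z\<close> xyz \<open>g > 0\<close> by (metis diff_gt_0_iff_gt zero_less_mult_pos2, metis add_pos_pos zero_less_mult_pos2)
  have y2: "y\<^sup>2 = g\<^sup>2 * (r * s)"
  proof -
    have "y\<^sup>2 = (z - x) * (z + x)" using xyz(1) by (simp add: power2_eq_square algebra_simps)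
    then show ?thesis unfolding rs(1,2) by (simp add: power2_eq_square mult_ac)
  qed
  then have "g\<^sup>2 dvd y\<^sup>2" by simp
  then have "g dvd y" by simp
  then obtain w where w: "y = g * w" by blast
  have "r * s = w\<^sup>2"
    using y2 \<open>g > 0\<close> by (simp add: w power_mult_distrib)
  then obtain a b where ab: "r = a\<^sup>2" "s = b\<^sup>2" "0 < a" "0 < b"
    using int_coprime_mult_eq_square[OF rs(3) _ rs_pos] by metis
  have "w\<^sup>2 = (a * b)\<^sup>2" using \<open>r * s = w\<^sup>2\<close> ab by (simp add: power_mult_distrib)
  moreover have "w > 0" using w xyz \<open>g > 0\<close> by (metis zero_less_mult_pos)
  ultimately have "w = a * b" using ab by (simp add: power2_eq_iff_nonneg)
  then show ?thesis
    using that[OF g ab(3,4)] rs ab w by (simp add: x_def y_def z_def mult.commute mult.left_commute)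
qed

text \<open>
  A primitive triple is determined by its parameters \<open>(g, a, b)\<close>, and both \<open>a\<close> and \<open>b\<close> are at most
  \<open>sqrt (2 * X)\<close>.
\<close>

lemma count_primitive_triples_le:
  assumes X: "X \<ge> 0"
  shows "real (count_upto (primitive_points pythagorean_cone) X) \<le> 4 * X"
proof -
  define N where "N = \<lfloor>sqrt (2 * X)\<rfloor>"
  (* The inverse of the parametrization; the divisions are exact on actual parameters. *)
  define F :: "int \<times> int \<times> int \<Rightarrow> int ^ 3" where
    "F = (\<lambda>(g, a, b). vector [(g * b\<^sup>2 - g * a\<^sup>2) div 2, g * a * b, (g * a\<^sup>2 + g * b\<^sup>2) div 2])"
  have N: "N \<ge> 0" using X by (simp add: N_def)
  have "{P \<in> primitive_points pythagorean_cone. real_of_int (height P) \<le> X} \<subseteq> F ` ({1, 2} \<times> {1..N} \<times> {1..N})"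
  proof
    fix P assume P: "P \<in> {P \<in> primitive_points pythagorean_cone. real_of_int (height P) \<le> X}"
    then have B: "P \<in> branch_locus pythagorean_cone" by (simp add: primitive_points_def)
    obtain g a b where gab: "g \<in> {1, 2}" "0 < a" "0 < b" and
      eqs: "P $ 3 - P $ 1 = g * a\<^sup>2" "P $ 3 + P $ 1 = g * b\<^sup>2" "P $ 2 = g * a * b"
      using P primitive_triple_parametrization by blast
    have "g * b\<^sup>2 - g * a\<^sup>2 = 2 * P $ 1" "g * a\<^sup>2 + g * b\<^sup>2 = 2 * P $ 3"
      by (simp_all flip: eqs)
    then have PF: "P = F (g, a, b)"
      using eqs(3) by (simp add: F_def vec_eq_iff forall_3)
    have pos: "0 < P $ 1" "0 < P $ 2" "0 < P $ 3" and "(P $ 1)\<^sup>2 + (P $ 2)\<^sup>2 = (P $ 3)\<^sup>2"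
      using B by (simp_all add: pythagorean_branch_locus_iff)
    then have "(P $ 1)\<^sup>2 \<le> (P $ 3)\<^sup>2" by (metis le_add_same_cancel1 zero_le_power2)
    then have x_le: "P $ 1 \<le> P $ 3" using pos by (auto intro: power2_le_imp_le)
    have le: "e \<le> N" if "0 < e" "g * e\<^sup>2 \<le> 2 * P $ 3" for e
    proof -
      have "1 * e\<^sup>2 \<le> g * e\<^sup>2" using gab(1) by (intro mult_right_mono) auto
      then have "e\<^sup>2 \<le> 2 * P $ 3" using that by linarith
      then have "real_of_int (e\<^sup>2) \<le> real_of_int (2 * P $ 3)" by (simp only: of_int_le_iff)
      also have "\<dots> \<le> 2 * X" using P pythagorean_height_le_iff[OF B] by simp
      finally have "real_of_int e \<le> sqrt (2 * X)" by (simp add: real_le_rsqrt)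
      then show ?thesis by (simp add: N_def le_floor_iff)
    qed
    have "a \<le> N" "b \<le> N"
      using pos x_le gab by (intro le; simp flip: eqs)+
    then show "P \<in> F ` ({1, 2} \<times> {1..N} \<times> {1..N})"
      using gab PF by auto
  qed
  then have "count_upto (primitive_points pythagorean_cone) X \<le> card ({1, 2 :: int} \<times> {1..N} \<times> {1..N})"
    unfolding count_upto_def by (intro surj_card_le) auto
  also have "\<dots> = 2 * (nat N * nat N)" by simp
  finally have "real (count_upto (primitive_points pythagorean_cone) X) \<le> real (2 * (nat N * nat N))"
    by (simp only: of_nat_le_iff)
  also have "\<dots> = 2 * (real_of_int N)\<^sup>2" using N by (simp add: power2_eq_square)
  also have "\<dots> \<le> 2 * (sqrt (2 * X))\<^sup>2"
    using N by (intro mult_left_mono power_mono) (simp_all add: N_def)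
  also have "\<dots> = 4 * X" using X by simp
  finally show ?thesis .
qed

section \<open>Primitive Pythagorean triples grow at least linearly\<close>

text \<open>
  For odd \<open>d\<close>, the solutions \<open>j\<close> form a single residue class modulo \<open>d\<close>, which meets every interval
  \<open>[q * d, (q + 1) * d)\<close> at most once.
\<close>

lemma card_dvd_odd_progression_le:
  fixes d a N :: nat
  assumes d: "odd d"
  shows "card {j \<in> {..<N}. d dvd a + 2 * j} \<le> N div d + 1"
proof -
  have eq: "i = j"
    if "i \<le> j" "i div d = j div d" "d dvd a + 2 * i" "d dvd a + 2 * j" for i j
  proof -
    have "d dvd (a + 2 * j) - (a + 2 * i)" using that by (intro dvd_diff_nat)
    also have "(a + 2 * j) - (a + 2 * i) = 2 * (j - i)" by simp
    finally have "d dvd j - i" using d by (simp add: coprime_dvd_mult_right_iff)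
    then have "j mod d = i mod d" using that by (simp add: mod_eq_dvd_iff_nat)
    then show ?thesis using that(2) by (metis div_mult_mod_eq)
  qed
  have "inj_on (\<lambda>j. j div d) {j \<in> {..<N}. d dvd a + 2 * j}"
    using eq by (intro inj_onI) (metis (mono_tags, lifting) mem_Collect_eq nat_le_linear)
  moreover have "(\<lambda>j. j div d) ` {j \<in> {..<N}. d dvd a + 2 * j} \<subseteq> {..N div d}"
    by (auto intro: div_le_mono)
  ultimately have "card {j \<in> {..<N}. d dvd a + 2 * j} \<le> card {..N div d}"
    by (intro card_inj_on_le) auto
  then show ?thesis by simp
qed

lemma card_dvd_le:
  fixes d N :: nat
  assumes "d > 0"
  shows "card {i \<in> {1..N}. d dvd i} \<le> N div d"
proof -
  have "{i \<in> {1..N}. d dvd i} \<subseteq> (\<lambda>k. d * k) ` {1..N div d}"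
    using assms by (auto simp: image_iff less_eq_div_iff_mult_less_eq mult.commute Suc_le_eq elim!: dvdE)
  then have "card {i \<in> {1..N}. d dvd i} \<le> card {1..N div d}"
    by (intro surj_card_le) auto
  then show ?thesis by simp
qed

text \<open>
  A telescoping comparison: \<open>(2 * k + 1)\<^sup>2 \<ge> 4 * k * (k + 1)\<close>. The bound must be below \<open>1 / 2\<close> for
  the union bound in the next lemma to leave a positive proportion of pairs.
\<close>

lemma sum_inverse_odd_squares_le:
  "(\<Sum>k=1..N. 1 / (real (2 * k + 1))\<^sup>2) \<le> 1 / 4"
proof -
  have "(\<Sum>k=1..N. 1 / (real (2 * k + 1))\<^sup>2) \<le> (1 - 1 / (real N + 1)) / 4"
  proof (induction N)
    case (Suc N)
    define n where "n = real N"
    have n: "n \<ge> 0" by (simp add: n_def)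
    have "1 / (2 * (n + 1) + 1)\<^sup>2 \<le> 1 / (4 * ((n + 1) * (n + 2)))"
      using n by (intro divide_left_mono) (auto simp: power2_eq_square algebra_simps intro: add_pos_nonneg)
    also have "\<dots> = (1 - 1 / (n + 2)) / 4 - (1 - 1 / (n + 1)) / 4"
      using n by (simp add: divide_simps) (simp add: algebra_simps)
    finally have "1 / (real (2 * Suc N + 1))\<^sup>2 \<le>
        (1 - 1 / (real (Suc N) + 1)) / 4 - (1 - 1 / (real N + 1)) / 4"
      by (simp add: n_def algebra_simps)
    moreover have "(\<Sum>k=1..Suc N. 1 / (real (2 * k + 1))\<^sup>2)
        = (\<Sum>k=1..N. 1 / (real (2 * k + 1))\<^sup>2) + 1 / (real (2 * Suc N + 1))\<^sup>2"
      by simp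
    ultimately show ?case using Suc by linarith
  qed simp
  also have "\<dots> \<le> 1 / 4" by simp
  finally show ?thesis .
qed

text \<open>
  Among pairs of an even number in \<open>(0, 2 * N]\<close> and an odd number in \<open>(2 * N, 4 * N)\<close>, a positive
  proportion is coprime. A common factor \<open>d > 1\<close> is odd, at least \<open>3\<close> and at most \<open>N\<close>; it occurs in at
  most \<open>2 * (N / d)\<^sup>2\<close> pairs, and these bounds add up to at most half of the \<open>N\<^sup>2\<close> pairs. The two ranges are
  disjoint so that the even number is the smaller one, as Euclid's formula requires.
\<close>

lemma card_coprime_pairs_ge:
  "(real N)\<^sup>2 / 2 \<le> card {(i, j) \<in> {1..N} \<times> {..<N}. coprime (2 * i) (2 * N + 1 + 2 * j)}"
proof -
  define C where "C = {(i, j) \<in> {1..N} \<times> {..<N}. coprime (2 * i) (2 * N + 1 + 2 * j)}"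
  define I where "I k = {i \<in> {1..N}. 2 * k + 1 dvd i}" for k
  define J where "J k = {j \<in> {..<N}. 2 * k + 1 dvd 2 * N + 1 + 2 * j}" for k
  have "({1..N} \<times> {..<N}) - C \<subseteq> (\<Union>k\<in>{1..N}. I k \<times> J k)"
  proof clarify
    fix i j assume i: "i \<in> {1..N}" and j: "j < N" and "(i, j) \<notin> C"
    then have not1: "gcd (2 * i) (2 * N + 1 + 2 * j) \<noteq> 1"
      by (auto simp: C_def coprime_iff_gcd_eq_1)
    define d where "d = gcd (2 * i) (2 * N + 1 + 2 * j)"
    have d: "d dvd 2 * i" "d dvd 2 * N + 1 + 2 * j" by (simp_all add: d_def)
    have "odd d"
    proof
      assume "even d"
      then have "even (2 * N + 1 + 2 * j)" using d(2) dvd_trans by blast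
      then show False by simp
    qed
    then obtain k where k: "d = 2 * k + 1" by (elim oddE)
    have di: "d dvd i" using d(1) \<open>odd d\<close> by (simp add: coprime_dvd_mult_right_iff)
    then have "d \<le> N" using i by (auto dest: dvd_imp_le)
    moreover have "k \<noteq> 0" using not1 k by (auto simp: d_def)
    ultimately have "k \<in> {1..N}" using k by simp
    then show "(i, j) \<in> (\<Union>k\<in>{1..N}. I k \<times> J k)"
      using i j di d k by (auto simp: I_def J_def)
  qed
  then have "card (({1..N} \<times> {..<N}) - C) \<le> card (\<Union>k\<in>{1..N}. I k \<times> J k)"
    by (intro card_mono) (auto simp: I_def J_def)
  also have "\<dots> \<le> (\<Sum>k=1..N. card (I k \<times> J k))"
    by (rule card_UN_le) simp
  finally have "real (card (({1..N} \<times> {..<N}) - C)) \<le> (\<Sum>k=1..N. real (card (I k \<times> J k)))"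
    by (simp only: of_nat_le_iff flip: of_nat_sum)
  also have "\<dots> \<le> (\<Sum>k=1..N. 2 * (real N)\<^sup>2 * (1 / (real (2 * k + 1))\<^sup>2))"
  proof (rule sum_mono)
    fix k
    define q where "q = N div (2 * k + 1)"
    have "card (I k) \<le> q" "card (J k) \<le> q + 1"
      unfolding I_def J_def q_def
      by (rule card_dvd_le, simp) (rule card_dvd_odd_progression_le, simp)
    then have "card (I k) * card (J k) \<le> q * (q + 1)" by (rule mult_mono) auto
    (* Both sides vanish for q = 0; otherwise the rounding term is absorbed by q + 1 \<le> 2 q. *)
    also have "\<dots> \<le> 2 * q\<^sup>2" by (cases q) (simp_all add: power2_eq_square)
    finally have "real (card (I k \<times> J k)) \<le> real (2 * q\<^sup>2)"
      by (simp only: card_cartesian_product of_nat_le_iff)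
    also have "\<dots> = 2 * (real q)\<^sup>2" by simp
    also have "\<dots> \<le> 2 * (real N / real (2 * k + 1))\<^sup>2"
      unfolding q_def by (intro mult_left_mono power_mono of_nat_div_le_of_nat) auto
    finally show "real (card (I k \<times> J k)) \<le> 2 * (real N)\<^sup>2 * (1 / (real (2 * k + 1))\<^sup>2)"
      by (simp add: power_divide)
  qed
  also have "\<dots> \<le> 2 * (real N)\<^sup>2 * (1 / 4)"
    unfolding sum_distrib_left[symmetric]
    by (intro mult_left_mono sum_inverse_odd_squares_le) simp
  finally have "real (card (({1..N} \<times> {..<N}) - C)) \<le> (real N)\<^sup>2 / 2" by simp
  moreover have "(real N)\<^sup>2 = real (card (({1..N} \<times> {..<N}) - C)) + real (card C)"
  proof -
    have "C \<subseteq> {1..N} \<times> {..<N}" by (auto simp: C_def)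
    then have "card ({1..N} \<times> {..<N}) = card (({1..N} \<times> {..<N}) - C) + card C"
      by (metis card_Diff_subset card_mono finite_SigmaI finite_atLeastAtMost finite_lessThan finite_subset le_add_diff_inverse2)
    then have "real (N * N) = real (card (({1..N} \<times> {..<N}) - C) + card C)" by simp
    then show ?thesis by (simp only: of_nat_add of_nat_mult power2_eq_square)
  qed
  ultimately have "(real N)\<^sup>2 / 2 \<le> card C" by linarith
  then show ?thesis unfolding C_def .
qed

text \<open>
  Euclid's formula \<open>(v\<^sup>2 - u\<^sup>2, 2 * u * v, u\<^sup>2 + v\<^sup>2)\<close> is injective and yields primitive triples for coprime
  \<open>u < v\<close> of opposite parity. With \<open>u \<le> 2 * N\<close> and \<open>v \<le> 4 * N\<close> the hypotenuse is at most
  \<open>20 * N\<^sup>2\<close>.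
\<close>

lemma count_primitive_triples_quadratic:
  "(real N)\<^sup>2 / 2 \<le> count_upto (primitive_points pythagorean_cone) (20 * (real N)\<^sup>2)"
proof -
  define C where "C = {(i, j) \<in> {1..N} \<times> {..<N}. coprime (2 * i) (2 * N + 1 + 2 * j)}"
  define u v where "u i = int (2 * i)" and "v j = int (2 * N + 1 + 2 * j)" for i j
  define T :: "nat \<times> nat \<Rightarrow> int ^ 3" where
    "T = (\<lambda>(i, j). vector [(v j)\<^sup>2 - (u i)\<^sup>2, 2 * u i * v j, (u i)\<^sup>2 + (v j)\<^sup>2])"
  have "inj_on T C"
  proof (rule inj_onI, clarify)
    fix i j i' j' assume "T (i, j) = T (i', j')"
    then have "(v j)\<^sup>2 - (u i)\<^sup>2 = (v j')\<^sup>2 - (u i')\<^sup>2" "(u i)\<^sup>2 + (v j)\<^sup>2 = (u i')\<^sup>2 + (v j')\<^sup>2"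
      by (simp_all add: T_def vec_eq_iff forall_3)
    then have "(u i)\<^sup>2 = (u i')\<^sup>2" "(v j)\<^sup>2 = (v j')\<^sup>2" by linarith+
    then have "u i = u i'" "v j = v j'"
      by (simp_all add: u_def v_def power2_eq_iff_nonneg)
    then show "i = i' \<and> j = j'" by (simp add: u_def v_def)
  qed
  moreover have "T ` C \<subseteq> {P \<in> primitive_points pythagorean_cone. real_of_int (height P) \<le> 20 * (real N)\<^sup>2}"
  proof clarify
    fix i j assume "(i, j) \<in> C"
    then have ij: "1 \<le> i" "i \<le> N" "j < N" and cop: "coprime (2 * i) (2 * N + 1 + 2 * j)"
      by (auto simp: C_def)
    have uv: "0 < u i" "u i < v j" "u i \<le> 2 * int N" "v j \<le> 4 * int N"
      using ij by (auto simp: u_def v_def)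
    have T: "T (i, j) $ 1 = (v j)\<^sup>2 - (u i)\<^sup>2" "T (i, j) $ 2 = 2 * u i * v j"
      "T (i, j) $ 3 = (u i)\<^sup>2 + (v j)\<^sup>2"
      by (simp_all add: T_def)
    have "(u i)\<^sup>2 < (v j)\<^sup>2" using uv by (intro power_strict_mono) auto
    then have B: "T (i, j) \<in> branch_locus pythagorean_cone"
      using uv by (auto simp: pythagorean_branch_locus_iff T power2_eq_square algebra_simps add_pos_pos)
    define d where "d = content (T (i, j))"
    have d: "d dvd (v j)\<^sup>2 - (u i)\<^sup>2" "d dvd (u i)\<^sup>2 + (v j)\<^sup>2"
      unfolding d_def using content_dvd[of "T (i, j)" 1] content_dvd[of "T (i, j)" 3] by (simp_all add: T)
    have "odd ((u i)\<^sup>2 + (v j)\<^sup>2)" by (simp add: u_def v_def)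
    then have "odd d" using d(2) dvd_trans by blast
    have "d dvd 2 * (u i)\<^sup>2" "d dvd 2 * (v j)\<^sup>2"
      using dvd_diff[OF d(2,1)] dvd_add[OF d] by simp_all
    then have "d dvd (u i)\<^sup>2" "d dvd (v j)\<^sup>2"
      using \<open>odd d\<close> by (simp_all add: coprime_dvd_mult_right_iff)
    moreover have "coprime ((u i)\<^sup>2) ((v j)\<^sup>2)"
    proof -
      have "coprime (u i) (v j)"
        using cop unfolding u_def v_def by (simp only: coprime_int_iff)
      then show ?thesis by simp
    qed
    ultimately have "is_unit d" by (rule coprime_common_divisor[rotated])
    then have "content (T (i, j)) = 1"
      using content_nonneg[of "T (i, j)"] by (simp add: d_def)
    moreover have "real_of_int (T (i, j) $ 3) \<le> 20 * (real N)\<^sup>2"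
    proof -
      have "(u i)\<^sup>2 \<le> (2 * int N)\<^sup>2" "(v j)\<^sup>2 \<le> (4 * int N)\<^sup>2"
        by (rule power_mono; use uv in simp)+
      then have "T (i, j) $ 3 \<le> 20 * (int N)\<^sup>2" by (simp add: T)
      then have "real_of_int (T (i, j) $ 3) \<le> real_of_int (20 * (int N)\<^sup>2)"
        by (simp only: of_int_le_iff)
      then show ?thesis by simp
    qed
    ultimately show "T (i, j) \<in> primitive_points pythagorean_cone \<and>
        real_of_int (height (T (i, j))) \<le> 20 * (real N)\<^sup>2"
      using B by (simp add: primitive_points_def pythagorean_height_le_iff)
  qed
  ultimately have "card C \<le> count_upto (primitive_points pythagorean_cone) (20 * (real N)\<^sup>2)"
    unfolding count_upto_def by (intro card_inj_on_le finite_points_upto)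
  then show ?thesis
    using card_coprime_pairs_ge[of N] unfolding C_def by linarith
qed

lemma count_primitive_triples_ge:
  assumes X: "X \<ge> 20"
  shows "X / 160 \<le> count_upto (primitive_points pythagorean_cone) X"
proof -
  (* N will be the largest integer with 20 N^2 \<le> X; rounding costs at most a factor 2, as r \<ge> 1. *)
  define r where "r = sqrt (X / 20)"
  define N where "N = nat \<lfloor>r\<rfloor>"
  have r: "r \<ge> 1" "r\<^sup>2 = X / 20" using X by (simp_all add: r_def)
  then have "\<lfloor>r\<rfloor> \<ge> 1" by (simp add: le_floor_iff)
  then have "real N = real_of_int \<lfloor>r\<rfloor>" "real_of_int \<lfloor>r\<rfloor> \<ge> 1" by (simp_all add: N_def)
  then have N: "real N \<le> r" "r \<le> 2 * real N" by linarith+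
  have "X / 20 \<le> (2 * real N)\<^sup>2"
    unfolding r(2)[symmetric] using r N by (intro power_mono) auto
  then have "X / 160 \<le> (real N)\<^sup>2 / 2" by simp
  also have "\<dots> \<le> count_upto (primitive_points pythagorean_cone) (20 * (real N)\<^sup>2)"
    by (rule count_primitive_triples_quadratic)
  also have "\<dots> \<le> count_upto (primitive_points pythagorean_cone) X"
  proof -
    have "(real N)\<^sup>2 \<le> r\<^sup>2" using N by (intro power_mono) auto
    then show ?thesis using r by (intro of_nat_mono count_upto_mono) simp
  qed
  finally show ?thesis .
qed

section \<open>Primitive triples have density zero\<close>

text \<open>
  The lower bound \<open>A (X / m) \<ge> X / (160 * m)\<close>, summed over the contents \<open>m \<le> M\<close>. It makes the number
  of all triples exceed every constant multiple of \<open>X\<close>.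
\<close>

lemma count_triples_ge:
  assumes "X \<ge> 20 * real M"
  shows "X * harm M / 160 \<le> count_upto (branch_locus pythagorean_cone) X"
proof -
  have "X * harm M / 160 = (\<Sum>m=1..M. X / real m / 160)"
    unfolding harm_def sum_distrib_left sum_divide_distrib
    by (intro sum.cong refl) (simp add: inverse_eq_divide)
  also have "\<dots> \<le> (\<Sum>m=1..M. real (count_upto (primitive_points pythagorean_cone) (X / real m)))"
  proof (rule sum_mono)
    fix m assume m: "m \<in> {1..M}"
    then have "20 * real m \<le> 20 * real M" by simp
    then have "20 * real m \<le> X" using assms by linarith
    then have "20 \<le> X / real m" using m by (simp add: field_simps)
    then show "X / real m / 160 \<le> real (count_upto (primitive_points pythagorean_cone) (X / real m))"
      by (rule count_primitive_triples_ge)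
  qed
  also have "\<dots> \<le> count_upto (branch_locus pythagorean_cone) X"
    using sum_primitive_le_count[OF scaling_closed_pythagorean, of X M] by (simp flip: of_nat_sum)
  finally show ?thesis .
qed

lemma eventually_triples: "eventually (\<lambda>X. count_upto (branch_locus pythagorean_cone) X > 0) at_top"
  using eventually_ge_at_top[of 20]
proof eventually_elim
  case (elim X)
  then show ?case using count_triples_ge[of 1 X] by (simp add: harm_def)
qed

text \<open>
  Primitive triples grow at most linearly in \<open>X\<close>, all triples faster than linearly.
\<close>

lemma primitive_triples_thin:
  "((\<lambda>X. real (count_upto (primitive_points pythagorean_cone) X) /
      real (count_upto (branch_locus pythagorean_cone) X)) \<longlongrightarrow> 0) at_top"
proof (rule tendstoI)
  fix e :: real assume e: "e > 0"
  (* 640 is the quotient of the constants 4 and 1 / 160 in the two growth bounds. *)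
  obtain M where M: "harm M > 640 / e"
    using harm_at_top by (metis (mono_tags, lifting) eventually_sequentially filterlim_at_top_dense order_refl)
  have h: "harm M > (0::real)" using M e by (meson divide_pos_pos less_trans zero_less_numeral)
  show "\<forall>\<^sub>F X in at_top. dist (real (count_upto (primitive_points pythagorean_cone) X) /
      real (count_upto (branch_locus pythagorean_cone) X)) 0 < e"
    using eventually_ge_at_top[of "20 * real M"] eventually_gt_at_top[of 0]
  proof eventually_elim
    case (elim X)
    have "real (count_upto (primitive_points pythagorean_cone) X) / count_upto (branch_locus pythagorean_cone) X
        \<le> 4 * X / (X * harm M / 160)"
      using elim h count_triples_ge[of M X] count_primitive_triples_le[of X] by (intro frac_le) simp_all
    also have "\<dots> = 640 / harm M" using elim by simp
    also have "\<dots> < e" using M e h by (simp add: field_simps)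
    finally show ?case by simp
  qed
qed

section \<open>The Euler product\<close>

definition smooth_harmonic_sum :: "nat set \<Rightarrow> nat \<Rightarrow> real"
  where "smooth_harmonic_sum S N = (\<Sum>n | n \<in> {1..N} \<and> prime_factors n \<subseteq> S. 1 / real n)"

text \<open>
  An integer \<open>n\<close> admitted for \<open>insert p S\<close> is either admitted for \<open>S\<close> or \<open>p\<close> times a smaller integer
  admitted for \<open>insert p S\<close>, so the sum \<open>F\<close> for \<open>insert p S\<close> is at most the sum for \<open>S\<close> plus \<open>F / p\<close>.
  Iterating this bound would produce the geometric series for \<open>1 / (1 - 1 / p)\<close>.
\<close>

lemma smooth_harmonic_sum_insert:
  assumes p: "prime p"
  shows "(1 - 1 / real p) * smooth_harmonic_sum (insert p S) N \<le> smooth_harmonic_sum S N"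
proof -
  let ?A = "\<lambda>S. {n \<in> {1..N}. prime_factors n \<subseteq> S}"
  have fin: "finite (?A S)" for S by simp
  have p0: "p > 0" using p by (simp add: prime_gt_0_nat)
  have "?A (insert p S) \<subseteq> ?A S \<union> (\<lambda>m. p * m) ` ?A (insert p S)"
  proof
    fix n assume n: "n \<in> ?A (insert p S)"
    show "n \<in> ?A S \<union> (\<lambda>m. p * m) ` ?A (insert p S)"
    proof (cases "p dvd n")
      case True
      then obtain m where m: "n = p * m" by blast
      then have "m \<noteq> 0" using n by auto
      then have "m \<in> ?A (insert p S)"
        using n m p p0 by (auto simp: prime_factors_product)
           (metis Suc_leI le_trans mult_le_mono1 nat_mult_1 One_nat_def)
      then show ?thesis using m by blast
    next
      case False
      then have "p \<notin> prime_factors n" by auto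
      then show ?thesis using n by auto
    qed
  qed
  then have "smooth_harmonic_sum (insert p S) N \<le> (\<Sum>n \<in> ?A S \<union> (\<lambda>m. p * m) ` ?A (insert p S). 1 / real n)"
    unfolding smooth_harmonic_sum_def by (intro sum_mono2) auto
  also have "\<dots> \<le> smooth_harmonic_sum S N + (\<Sum>n \<in> (\<lambda>m. p * m) ` ?A (insert p S). 1 / real n)"
    unfolding smooth_harmonic_sum_def by (subst sum_Un) (auto intro!: sum_nonneg)
  also have "(\<Sum>n \<in> (\<lambda>m. p * m) ` ?A (insert p S). 1 / real n) = (1 / real p) * smooth_harmonic_sum (insert p S) N"
    unfolding smooth_harmonic_sum_def sum_distrib_left
    using p0 by (subst sum.reindex) (auto simp: inj_on_def)
  finally show ?thesis by (simp add: algebra_simps)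
qed

lemma one_minus_inverse_prime_nonneg: "prime p \<Longrightarrow> 0 \<le> 1 - 1 / real p"
  using prime_ge_1_nat[of p] by (simp add: divide_le_eq_1)

lemma euler_product_mult_smooth_sum_le_1:
  assumes "finite S" "\<And>p. p \<in> S \<Longrightarrow> prime p"
  shows "(\<Prod>p\<in>S. 1 - 1 / real p) * smooth_harmonic_sum S N \<le> 1"
  using assms
proof (induction S rule: finite_induct)
  case empty
  have "{n \<in> {1..N}. prime_factors n \<subseteq> {}} \<subseteq> {1}"
  proof
    fix n assume "n \<in> {n \<in> {1..N}. prime_factors n \<subseteq> {}}"
    then show "n \<in> {1}" by (auto simp: set_mset_eq_empty_iff prime_factorization_empty_iff)
  qed
  then have "smooth_harmonic_sum {} N \<le> (\<Sum>n\<in>{1}. 1 / real n)"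
    unfolding smooth_harmonic_sum_def by (intro sum_mono2) auto
  then show ?case by simp
next
  case (insert p S)
  have "(\<Prod>q\<in>insert p S. 1 - 1 / real q) * smooth_harmonic_sum (insert p S) N
      = (\<Prod>q\<in>S. 1 - 1 / real q) * ((1 - 1 / real p) * smooth_harmonic_sum (insert p S) N)"
    using insert by (simp add: mult_ac)
  also have "\<dots> \<le> (\<Prod>q\<in>S. 1 - 1 / real q) * smooth_harmonic_sum S N"
    using insert by (intro mult_left_mono smooth_harmonic_sum_insert prod_nonneg
        one_minus_inverse_prime_nonneg) auto
  also have "\<dots> \<le> 1" using insert by auto
  finally show ?case .
qed

text \<open>
  If \<open>S\<close> consists of all primes up to \<open>Y\<close>, the smooth sum up to \<open>Y\<close> is the full harmonic sum, which
  diverges.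
\<close>

lemma euler_product_tendsto_0:
  "(\<lambda>Y::nat. \<Prod>p | prime p \<and> p \<le> Y. 1 - 1 / real p) \<longlonglongrightarrow> 0"
proof (rule tendsto_sandwich)
  have fin: "finite {p. prime p \<and> p \<le> (Y::nat)}" for Y
    by (rule finite_subset[of _ "{..Y}"]) auto
  show "\<forall>\<^sub>F Y in sequentially. 0 \<le> (\<Prod>p | prime p \<and> p \<le> (Y::nat). 1 - 1 / real p)"
    by (intro always_eventually allI prod_nonneg one_minus_inverse_prime_nonneg) auto
  show "\<forall>\<^sub>F Y in sequentially. (\<Prod>p | prime p \<and> p \<le> Y. 1 - 1 / real p) \<le> inverse (harm Y)"
    using eventually_gt_at_top[of 0]
  proof eventually_elim
    case (elim Y)
    let ?S = "{p. prime p \<and> p \<le> Y}"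
    have "{n. n \<in> {1..Y} \<and> prime_factors n \<subseteq> ?S} = {1..Y}"
      by (auto dest!: dvd_imp_le)
    then have "smooth_harmonic_sum ?S Y = harm Y"
      by (simp only: smooth_harmonic_sum_def harm_def inverse_eq_divide)
    moreover have "(\<Prod>p\<in>?S. 1 - 1 / real p) * smooth_harmonic_sum ?S Y \<le> 1"
      by (rule euler_product_mult_smooth_sum_le_1[OF fin]) simp
    ultimately have "(\<Prod>p\<in>?S. 1 - 1 / real p) * harm Y \<le> 1" by (simp only:)
    then show ?case using harm_pos[OF elim, where 'a=real] by (simp add: field_simps)
  qed
  show "(\<lambda>Y. inverse (harm Y :: real)) \<longlonglongrightarrow> 0"
    by (rule tendsto_inverse_0_at_top[OF harm_at_top])
qed simp

section \<open>Visibility on the Pythagorean cone\<close>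

theorem proposition4p9:
  fixes rep :: "(rat ^ 3) set \<Rightarrow> rat ^ 3"
  assumes "ray_representatives pythagorean_cone rep"
  shows "(visible_proportion pythagorean_cone rep \<longlongrightarrow> 0) at_top \<and>
    visible_density pythagorean_cone rep = 0 \<and>
    (\<forall>p. prime p \<longrightarrow>
      (adically_visible_proportion p pythagorean_cone rep \<longlongrightarrow> 1 - 1 / real p) at_top \<and>
      adically_visible_density p pythagorean_cone rep = 1 - 1 / real p) \<and>
    (\<forall>(c, t) \<in> branch_points pythagorean_cone rep.
      globally_visible rep c t \<longleftrightarrow> (\<forall>p. prime p \<longrightarrow> adically_visible p rep c t)) \<and>
    (\<lambda>Y::nat. \<Prod>p | prime p \<and> p \<le> Y. adically_visible_density p pythagorean_cone rep)
      \<longlonglongrightarrow> visible_density pythagorean_cone rep"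
proof -
  have glob: "(visible_proportion pythagorean_cone rep \<longlongrightarrow> 0) at_top"
    using primitive_triples_thin
    by (simp add: visible_proportion_def points_where_eq[OF assms globally_visible_iff]
        global_proportion_eq[abs_def])
  have adic: "(adically_visible_proportion p pythagorean_cone rep \<longlongrightarrow> 1 - 1 / real p) at_top"
    if "prime p" for p
    using adic_proportion_tendsto[OF scaling_closed_pythagorean prime_gt_0_nat[OF that]
        primitive_triples_thin eventually_triples]
    by (simp add: adically_visible_proportion_def
        points_where_eq[OF assms adically_visible_iff[OF _ _ _ that]])
  have glob_density: "visible_density pythagorean_cone rep = 0"
    unfolding visible_density_def by (rule tendsto_Lim[OF _ glob]) simp
  have adic_density: "adically_visible_density p pythagorean_cone rep = 1 - 1 / real p"
    if "prime p" for p
    unfolding adically_visible_density_def by (rule tendsto_Lim[OF _ adic[OF that]]) simp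
  have "(\<lambda>Y::nat. \<Prod>p | prime p \<and> p \<le> Y. adically_visible_density p pythagorean_cone rep)
      = (\<lambda>Y. \<Prod>p | prime p \<and> p \<le> Y. 1 - 1 / real p)"
    by (intro ext prod.cong) (auto simp: adic_density)
  then have "(\<lambda>Y::nat. \<Prod>p | prime p \<and> p \<le> Y. adically_visible_density p pythagorean_cone rep)
      \<longlonglongrightarrow> visible_density pythagorean_cone rep"
    using euler_product_tendsto_0 by (simp add: glob_density)
  moreover have "\<forall>(c, t) \<in> branch_points pythagorean_cone rep.
      globally_visible rep c t \<longleftrightarrow> (\<forall>p. prime p \<longrightarrow> adically_visible p rep c t)"
    by clarify (rule globally_visible_iff_adically_visible)
  ultimately show ?thesis
    using glob adic glob_density adic_density by blast
qed

end
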